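(* Let $x_1,\dots,x_n\in\mathbb{R}^p$ be data points, exactly $m$ of which lie on a $d$-dimensional linear subspace $L\subset\mathbb{R}^p$, where $1\le d<p$ and $m\ge d+1$, and suppose that every $q$-tuple of data points with $q\le p$ is linearly independent unless it includes at least $d+1$ points from $L$. Then the RANSAC algorithm for subspace recovery (described in the context) is exact, i.e. the subspace it returns is $L$, and its number of iterations has the geometric distribution (supported on the positive integers) with success probability $$\theta_1 := \binom{m}{d+1}\Big/\binom{n}{d+1}.$$ Thus the expected number of iterations is $1/\theta_1=\binom{n}{d+1}/\binom{m}{d+1}$, which is of order $O(n/m)^{d+1}$ when $d$ is held fixed (that is, for each fixed $d$ there is a constant $C_d$ such that $1/\theta_1\le C_d\,(n/m)^{d+1}$ for all $n\ge m\ge d+1$).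
   Context: A $q$-tuple of data points is a selection of $q$ of the $n$ data points with distinct indices (order is irrelevant), so there are $\binom{n}{q}$ of them. Points are identified with vectors; linear (in)dependence of points means linear (in)dependence as vectors. RANSAC algorithm for subspace recovery. Input: data points $x_1,\dots,x_n\in\mathbb{R}^p$ and the dimension $d$. Repeat: select a $(d+1)$-tuple of data points uniformly at random among all $(d+1)$-tuples, independently of previous draws (so the tuples are drawn with replacement); stop as soon as the drawn tuple is linearly dependent. Return the linear subspace spanned by that last tuple. The number of iterations is the number of tuples drawn, including the last one. The geometric distribution with success probability $\theta$ supported on the positive integers assigns probability $(1-\theta)^{k-1}\theta$ to $k\ge 1$. *)

theory Defs
  imports "HOL-Probability.Probability"
begin

text \<open>
  Data points are a family \<open>x :: nat \<Rightarrow> real ^ 'p\<close> whose values at the indices \<open>1, \<dots>, n\<close> matter.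
  A \<open>q\<close>-tuple is a set of \<open>q\<close> indices, so coinciding data points with distinct indices are kept
  apart.
\<close>

definition data_tuples :: "nat \<Rightarrow> nat \<Rightarrow> nat set set" where
  "data_tuples n q = {T. T \<subseteq> {1..n} \<and> card T = q}"

text \<open>
  Linear independence of the family indexed by \<open>T\<close>, not of the set \<open>x ` T\<close>: a tuple in which a
  vector is repeated is linearly dependent.
\<close>

definition lin_indep_tuple :: "(nat \<Rightarrow> real ^ 'p) \<Rightarrow> nat set \<Rightarrow> bool" where
  "lin_indep_tuple x T \<longleftrightarrow>
     (\<forall>c :: nat \<Rightarrow> real. (\<Sum>i\<in>T. c i *\<^sub>R x i) = 0 \<longrightarrow> (\<forall>i\<in>T. c i = 0))"

text \<open>
  A run of RANSAC is a function of the sequence \<open>T 0, T 1, \<dots>\<close> of tuples that would be drawn if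
  the loop never stopped; the first draw is \<open>T 0\<close>, so stopping at \<open>T k\<close> takes \<open>k + 1\<close> iterations.
  If no tuple is ever dependent there is no output and the number of iterations is infinite.
\<close>

definition ransac_halts :: "(nat \<Rightarrow> real ^ 'p) \<Rightarrow> (nat \<Rightarrow> nat set) \<Rightarrow> bool" where
  "ransac_halts x T \<longleftrightarrow> (\<exists>k. \<not> lin_indep_tuple x (T k))"

definition ransac_iterations :: "(nat \<Rightarrow> real ^ 'p) \<Rightarrow> (nat \<Rightarrow> nat set) \<Rightarrow> enat" where
  "ransac_iterations x T =
     (if ransac_halts x T then enat (Suc (LEAST k. \<not> lin_indep_tuple x (T k))) else \<infinity>)"

definition ransac_output :: "(nat \<Rightarrow> real ^ 'p) \<Rightarrow> (nat \<Rightarrow> nat set) \<Rightarrow> (real ^ 'p) set option" where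
  "ransac_output x T =
     (if ransac_halts x T then Some (span (x ` T (LEAST k. \<not> lin_indep_tuple x (T k)))) else None)"

text \<open>
  The randomness of RANSAC on \<open>n\<close> data points with dimension \<open>d\<close>: the draws are independent and
  each is uniform on the \<open>(d + 1)\<close>-tuples.
\<close>

definition ransac_draws :: "'w measure \<Rightarrow> nat \<Rightarrow> nat \<Rightarrow> (nat \<Rightarrow> 'w \<Rightarrow> nat set) \<Rightarrow> bool" where
  "ransac_draws M n d draw \<longleftrightarrow>
     prob_space M \<and>
     prob_space.indep_vars M (\<lambda>_. count_space (data_tuples n (d + 1))) draw UNIV \<and>
     (\<forall>k. distr M (count_space (data_tuples n (d + 1))) (draw k)
            = uniform_count_measure (data_tuples n (d + 1)))"

definition ransac_theta :: "nat \<Rightarrow> nat \<Rightarrow> nat \<Rightarrow> real" where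
  "ransac_theta n m d = real (m choose (d + 1)) / real (n choose (d + 1))"

text \<open>
  The library's \<^const>\<open>geometric_pmf\<close> counts failures and is supported on \<open>0, 1, \<dots>\<close>; here trials
  are counted.
\<close>

definition geometric_pos_pmf :: "real \<Rightarrow> nat pmf" where
  "geometric_pos_pmf \<theta> = map_pmf Suc (geometric_pmf \<theta>)"

lemma pmf_geometric_pos:
  assumes "0 < \<theta>" "\<theta> \<le> 1" "1 \<le> k"
  shows "pmf (geometric_pos_pmf \<theta>) k = (1 - \<theta>) ^ (k - 1) * \<theta>"
proof -
  obtain j where "k = Suc j"
    using assms(3) by (cases k) auto
  then show ?thesis
    using assms by (simp add: geometric_pos_pmf_def pmf_map_inj')
qed

lemma ransac_draws_exist:
  assumes "d + 1 \<le> n"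
  shows "ransac_draws (PiM UNIV (\<lambda>_::nat. uniform_count_measure (data_tuples n (d + 1))))
           n d (\<lambda>k \<omega>. \<omega> k)"
proof -
  let ?A = "data_tuples n (d + 1)"
  let ?U = "uniform_count_measure ?A"
  let ?P = "PiM UNIV (\<lambda>_::nat. ?U)"
  have fin: "finite ?A"
    by (rule finite_subset[of _ "Pow {1..n}"]) (auto simp: data_tuples_def)
  have "{1..d + 1} \<in> ?A"
    using assms by (auto simp: data_tuples_def)
  then have U: "prob_space ?U"
    using fin by (intro prob_space_uniform_count_measure) auto
  then interpret product_prob_space "\<lambda>_::nat. ?U" UNIV
    by (simp add: product_prob_space_def product_prob_space_axioms_def product_sigma_finite_def
        prob_space_imp_sigma_finite)
  have sets: "sets ?U = sets (count_space ?A)"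
    by (simp add: sets_uniform_count_measure)
  have comp: "distr ?P ?U (\<lambda>\<omega>. \<omega> k) = ?U" for k
    using PiM_component[of k] by simp
  have "prob_space.indep_vars ?P (\<lambda>_. ?U) (\<lambda>k \<omega>. \<omega> k) UNIV"
  proof (subst prob_space.indep_vars_iff_distr_eq_PiM')
    show "prob_space ?P" by unfold_locales
    have "distr ?P ?P (\<lambda>\<omega>. \<lambda>i\<in>UNIV. \<omega> i) = ?P"
      by (simp add: restrict_def)
    moreover have "PiM UNIV (\<lambda>i. distr ?P ?U (\<lambda>\<omega>. \<omega> i)) = ?P"
      by (simp only: comp)
    ultimately show "distr ?P ?P (\<lambda>\<omega>. \<lambda>i\<in>UNIV. \<omega> i) = PiM UNIV (\<lambda>i. distr ?P ?U (\<lambda>\<omega>. \<omega> i))"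
      by simp
  qed auto
  moreover have "(\<lambda>T. T) \<in> measurable ?U (count_space ?A)"
    using measurable_ident_sets[OF sets] .
  ultimately have "prob_space.indep_vars ?P (\<lambda>_. count_space ?A) (\<lambda>k \<omega>. \<omega> k) UNIV"
    by (rule prob_space.indep_vars_compose2[OF P.prob_space_axioms, where Y = "\<lambda>_ T. T"])
  moreover have "distr ?P (count_space ?A) (\<lambda>\<omega>. \<omega> k) = ?U" for k
  proof -
    have "distr ?P (count_space ?A) (\<lambda>\<omega>. \<omega> k) = distr ?P ?U (\<lambda>\<omega>. \<omega> k)"
      by (rule distr_cong) (simp_all add: sets_uniform_count_measure)
    then show ?thesis
      by (simp only: comp)
  qed
  ultimately show ?thesis
    unfolding ransac_draws_def using P.prob_space_axioms by blast
qed

end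

theory Submission
  imports Defs
begin

text \<open>
  A dependent \<open>(d + 1)\<close>-tuple has all its points in \<open>L\<close> by general position; conversely \<open>d + 1\<close>
  points of \<open>L\<close> are dependent because \<open>dim L = d\<close>, and they span \<open>L\<close> because any \<open>d\<close> of them
  are again in general position, hence independent. So a draw succeeds with probability
  \<open>\<theta>\<^sub>1\<close>, and RANSAC waits for the first success in independent trials. The order estimate follows
  from \<open>(m / k)^k \<le> (m choose k)\<close> and \<open>(n choose k) \<le> n^k\<close> with \<open>k = d + 1\<close>.
\<close>

section \<open>Linear algebra: dependent tuples and their spans\<close>

lemma lin_indep_tuple_inj_on:
  assumes "lin_indep_tuple x T" "finite T"
  shows "inj_on x T"
proof (rule inj_onI, rule ccontr)
  fix i j assume ij: "i \<in> T" "j \<in> T" "x i = x j" "i \<noteq> j"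
  \<comment> \<open>Equal vectors at two indices satisfy the nontrivial relation
    \<open>x i - x j = 0\<close>; these are its coefficients.\<close>
  define c where "c k = (if k = i then 1 else if k = j then - 1 else (0::real))" for k
  have "(\<Sum>k\<in>T. c k *\<^sub>R x k) = (\<Sum>k\<in>{i, j}. c k *\<^sub>R x k)"
    using assms(2) ij by (intro sum.mono_neutral_right) (auto simp: c_def)
  also have "\<dots> = 0"
    using ij by (simp add: c_def)
  finally have "c i = 0"
    using assms(1) ij(1) unfolding lin_indep_tuple_def by blast
  then show False
    by (simp add: c_def)
qed

lemma lin_indep_tuple_independent:
  assumes "lin_indep_tuple x T" "finite T"
  shows "independent (x ` T)"
  unfolding independent_explicit
proof (intro conjI allI impI)
  fix c assume "(\<Sum>v\<in>x ` T. c v *\<^sub>R v) = 0"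
  then have "(\<Sum>i\<in>T. c (x i) *\<^sub>R x i) = 0"
    by (simp add: sum.reindex[OF lin_indep_tuple_inj_on[OF assms]])
  then have "\<forall>i\<in>T. c (x i) = 0"
    using assms(1) unfolding lin_indep_tuple_def by (elim allE[of _ "\<lambda>i. c (x i)"]) simp
  then show "\<forall>v\<in>x ` T. c v = 0"
    by blast
qed (use assms in simp)

lemma dim_lin_indep_tuple:
  assumes "lin_indep_tuple x T" "finite T"
  shows "dim (x ` T) = card T"
  using assms
  by (simp add: dim_eq_card_independent lin_indep_tuple_independent card_image
      lin_indep_tuple_inj_on)

lemma finite_data_tuples: "finite (data_tuples n q)"
  by (rule finite_subset[of _ "Pow {1..n}"]) (auto simp: data_tuples_def)

lemma finite_mem_data_tuples: "T \<in> data_tuples n q \<Longrightarrow> finite T"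
  by (auto simp: data_tuples_def intro: finite_subset)

lemma card_data_tuples: "card (data_tuples n q) = n choose q"
  unfolding data_tuples_def by (subst n_subsets) auto

text \<open>Left to right, general position is used with \<open>q = d + 1\<close>, admissible
  because \<open>d < CARD('p)\<close>: the tuple has at least \<open>d + 1\<close> indices in
  \<open>L\<close>, hence all of them. Right to left, independence would put \<open>d + 1\<close>
  dimensions inside \<open>L\<close>.\<close>

lemma lin_dep_tuple_iff:
  fixes x :: "nat \<Rightarrow> real ^ 'p"
  assumes "dim L = d" "d < CARD('p)"
    and gp: "\<And>q T. q \<le> CARD('p) \<Longrightarrow> T \<in> data_tuples n q \<Longrightarrow>
           \<not> d + 1 \<le> card {i \<in> T. x i \<in> L} \<Longrightarrow> lin_indep_tuple x T"
    and T: "T \<in> data_tuples n (d + 1)"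
  shows "\<not> lin_indep_tuple x T \<longleftrightarrow> x ` T \<subseteq> L"
proof
  assume "\<not> lin_indep_tuple x T"
  then have "d + 1 \<le> card {i \<in> T. x i \<in> L}"
    using gp[OF _ T] assms(2) by auto
  moreover have "card T = d + 1"
    using T by (simp add: data_tuples_def)
  ultimately have "{i \<in> T. x i \<in> L} = T"
    using finite_mem_data_tuples[OF T] by (intro card_seteq) auto
  then show "x ` T \<subseteq> L"
    by blast
next
  assume "x ` T \<subseteq> L"
  then have "dim (x ` T) \<le> d"
    using assms(1) dim_subset by blast
  then show "\<not> lin_indep_tuple x T"
    using dim_lin_indep_tuple[of x T] finite_mem_data_tuples[OF T] T
    by (auto simp: data_tuples_def)
qed

lemma span_tuple_in_subspace:
  fixes x :: "nat \<Rightarrow> real ^ 'p"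
  assumes "subspace L" "dim L = d" "d < CARD('p)"
    and gp: "\<And>q T. q \<le> CARD('p) \<Longrightarrow> T \<in> data_tuples n q \<Longrightarrow>
           \<not> d + 1 \<le> card {i \<in> T. x i \<in> L} \<Longrightarrow> lin_indep_tuple x T"
    and T: "T \<in> data_tuples n (d + 1)" and "x ` T \<subseteq> L"
  shows "span (x ` T) = L"
proof (rule subspace_dim_equal)
  \<comment> \<open>With only \<open>d\<close> indices, \<open>S\<close> cannot contain
    \<open>d + 1\<close> points of \<open>L\<close>, so general position makes it independent. Its
    span then already has the dimension of \<open>L\<close>.\<close>
  obtain S where S: "S \<subseteq> T" "card S = d"
    using T obtain_subset_with_card_n[of d T] by (auto simp: data_tuples_def)
  then have "finite S"
    using finite_mem_data_tuples[OF T] finite_subset by blast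
  then have "card {i \<in> S. x i \<in> L} \<le> card S"
    by (intro card_mono) auto
  moreover have "S \<in> data_tuples n d"
    using S T by (auto simp: data_tuples_def)
  ultimately have "lin_indep_tuple x S"
    using gp[of d S] assms(3) S(2) by simp
  then have "dim (x ` S) = d"
    using \<open>finite S\<close> S(2) dim_lin_indep_tuple by blast
  moreover have "dim (x ` S) \<le> dim (x ` T)"
    using S(1) by (intro dim_subset) auto
  ultimately show "dim L \<le> dim (span (x ` T))"
    using assms(2) by simp
  show "span (x ` T) \<subseteq> L"
    using assms(1,6) by (simp add: span_minimal)
qed (use assms(1) in auto)

section \<open>Waiting time for the first success in independent trials\<close>

text \<open>Every event about \<open>N\<close> reduces to prescribed outcomes of finitely many
  trials, whose probabilities multiply. The type \<open>enat\<close> leaves room for the null event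
  that no trial succeeds.\<close>

lemma (in prob_space) first_success_geometric:
  fixes P :: "nat \<Rightarrow> 'a \<Rightarrow> bool" and \<theta> :: real
  defines "N \<equiv> \<lambda>\<omega>. if \<exists>k. P k \<omega> then enat (Suc (LEAST k. P k \<omega>)) else \<infinity>"
  assumes indep: "indep_vars (\<lambda>_. count_space UNIV) P UNIV"
    and prob: "\<And>k. prob {\<omega> \<in> space M. P k \<omega>} = \<theta>"
    and "0 < \<theta>"
  shows "N \<in> measurable M (count_space UNIV)"
    and "distr M (count_space UNIV) N = measure_pmf (map_pmf enat (geometric_pos_pmf \<theta>))"
    and "AE \<omega> in M. \<exists>k. P k \<omega>"
proof -
  have meas [measurable]: "Measurable.pred M (P k)" for k
    using indep by (simp add: indep_vars_def)
  have "\<theta> \<le> 1"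
    using prob[of 0] prob_le_1[of "{\<omega> \<in> space M. P 0 \<omega>}"] by simp
  show N [measurable]: "N \<in> measurable M (count_space UNIV)"
    unfolding N_def by measurable
  \<comment> \<open>The pattern \<open>b\<close> is arbitrary so that one computation serves both
    "all fail" and "first success at \<open>k\<close>". Empty \<open>J\<close> is treated apart,
    since the product rule for independent variables is applied to a nonempty index set.\<close>
  have word: "prob {\<omega> \<in> space M. \<forall>j\<in>J. P j \<omega> = b j} = (\<Prod>j\<in>J. if b j then \<theta> else 1 - \<theta>)"
    if "finite J" for J and b :: "nat \<Rightarrow> bool"
  proof (cases "J = {}")
    case True
    then show ?thesis
      by (simp add: prob_space)
  next
    case False
    have "prob {\<omega> \<in> space M. \<forall>j\<in>J. P j \<omega> = b j}
      = prob (\<Inter>j\<in>J. P j -` {b j} \<inter> space M)"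
      using False by (intro arg_cong[where f = prob]) auto
    also have "\<dots> = (\<Prod>j\<in>J. prob (P j -` {b j} \<inter> space M))"
      using indep_varsD[OF indep False that] by simp
    also have "\<dots> = (\<Prod>j\<in>J. if b j then \<theta> else 1 - \<theta>)"
    proof (rule prod.cong)
      fix j assume "j \<in> J"
      have "P j -` {True} \<inter> space M = {\<omega> \<in> space M. P j \<omega>}"
        "P j -` {False} \<inter> space M = {\<omega> \<in> space M. \<not> P j \<omega>}"
        by auto
      then show "prob (P j -` {b j} \<inter> space M) = (if b j then \<theta> else 1 - \<theta>)"
        using prob[of j] by (cases "b j") (auto simp: prob_neg)
    qed simp
    finally show ?thesis .
  qed
  have fail: "prob {\<omega> \<in> space M. \<forall>j<k. \<not> P j \<omega>} = (1 - \<theta>) ^ k" for k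
    using word[of "{..<k}" "\<lambda>_. False"] by (simp add: Ball_def)
  \<comment> \<open>Never succeeding implies failing in the first \<open>k\<close> trials, for every
    \<open>k\<close>; since \<open>\<theta> > 0\<close>, the bound tends to 0.\<close>
  have "prob {\<omega> \<in> space M. \<forall>k. \<not> P k \<omega>} \<le> (1 - \<theta>) ^ k" for k
    unfolding fail[symmetric] by (rule finite_measure_mono) auto
  moreover have "(\<lambda>k. (1 - \<theta>) ^ k) \<longlonglongrightarrow> 0"
    using \<open>0 < \<theta>\<close> \<open>\<theta> \<le> 1\<close> by (intro LIMSEQ_power_zero) auto
  ultimately have "prob {\<omega> \<in> space M. \<forall>k. \<not> P k \<omega>} \<le> 0"
    by (intro LIMSEQ_le_const) auto
  then have never: "prob {\<omega> \<in> space M. \<forall>k. \<not> P k \<omega>} = 0"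
    by (simp add: measure_le_0_iff)
  then show "AE \<omega> in M. \<exists>k. P k \<omega>"
    by (subst (asm) prob_eq_0) auto
  \<comment> \<open>On the countable type \<open>enat\<close> it suffices to compare singletons. The
    points \<open>\<infinity>\<close> and \<open>0\<close> have mass zero on both sides; the point
    \<open>Suc k\<close> carries the geometric weight.\<close>
  show "distr M (count_space UNIV) N = measure_pmf (map_pmf enat (geometric_pos_pmf \<theta>))"
  proof (rule measure_eqI_countable[where A = UNIV])
    fix a :: enat
    have "emeasure (distr M (count_space UNIV) N) {a} = ennreal (prob {\<omega> \<in> space M. N \<omega> = a})"
      by (subst emeasure_distr)
        (auto simp: emeasure_eq_measure intro!: arg_cong[where f = prob])
    also have "prob {\<omega> \<in> space M. N \<omega> = a} = pmf (map_pmf enat (geometric_pos_pmf \<theta>)) a"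
    proof (cases a)
      case infinity
      then have "{\<omega> \<in> space M. N \<omega> = a} = {\<omega> \<in> space M. \<forall>k. \<not> P k \<omega>}"
        by (auto simp: N_def)
      moreover have "pmf (map_pmf enat (geometric_pos_pmf \<theta>)) a = 0"
        using infinity by (intro pmf_map_outside) auto
      ultimately show ?thesis
        using never by simp
    next
      case (enat i)
      have pmf: "pmf (map_pmf enat (geometric_pos_pmf \<theta>)) a = pmf (geometric_pos_pmf \<theta>) i"
        unfolding enat by (rule pmf_map_inj') (simp add: inj_on_def)
      show ?thesis
      proof (cases i)
        case 0
        have N_empty: "{\<omega> \<in> space M. N \<omega> = enat 0} = {}"
          by (auto simp: N_def)
        have "0 \<notin> set_pmf (geometric_pos_pmf \<theta>)"
          by (auto simp: geometric_pos_pmf_def)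
        then show ?thesis
          by (simp only: pmf) (simp add: enat 0 N_empty set_pmf_iff del: Collect_empty_eq)
      next
        case (Suc k)
        have "N \<omega> = a \<longleftrightarrow> (\<exists>j. P j \<omega>) \<and> (LEAST j. P j \<omega>) = k" for \<omega>
          by (simp add: N_def enat Suc)
        moreover have "(\<exists>j. P j \<omega>) \<and> (LEAST j. P j \<omega>) = k \<longleftrightarrow> P k \<omega> \<and> (\<forall>j<k. \<not> P j \<omega>)" for \<omega>
        proof
          assume "(\<exists>j. P j \<omega>) \<and> (LEAST j. P j \<omega>) = k"
          then show "P k \<omega> \<and> (\<forall>j<k. \<not> P j \<omega>)"
            using LeastI_ex[of "\<lambda>j. P j \<omega>"] not_less_Least[of _ "\<lambda>j. P j \<omega>"] by blast
        next
          assume *: "P k \<omega> \<and> (\<forall>j<k. \<not> P j \<omega>)"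
          then have "(LEAST j. P j \<omega>) = k"
            by (intro Least_equality) (auto simp: not_less[symmetric])
          with * show "(\<exists>j. P j \<omega>) \<and> (LEAST j. P j \<omega>) = k"
            by blast
        qed
        \<comment> \<open>First success at trial \<open>k\<close> is the pattern
          \<open>b j = (j = k)\<close> on \<open>{..k}\<close>, so \<open>word\<close> yields one
          factor \<open>\<theta>\<close> and \<open>k\<close> factors
          \<open>1 - \<theta>\<close>.\<close>
        moreover have "P k \<omega> \<and> (\<forall>j<k. \<not> P j \<omega>) \<longleftrightarrow> (\<forall>j\<in>{..k}. P j \<omega> = (j = k))" for \<omega>
          by (auto simp: le_less)
        ultimately have "prob {\<omega> \<in> space M. N \<omega> = a} = (\<Prod>j\<le>k. if j = k then \<theta> else 1 - \<theta>)"
          using word[of "{..k}" "\<lambda>j. j = k"] by simp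
        also have "\<dots> = (1 - \<theta>) ^ k * \<theta>"
          by (simp add: lessThan_Suc_atMost[symmetric])
        also have "\<dots> = pmf (geometric_pos_pmf \<theta>) i"
          using pmf_geometric_pos[OF \<open>0 < \<theta>\<close> \<open>\<theta> \<le> 1\<close>, of i] by (simp add: Suc)
        finally show ?thesis
          by (simp only: pmf)
      qed
    qed
    also have "ennreal \<dots> = emeasure (measure_pmf (map_pmf enat (geometric_pos_pmf \<theta>))) {a}"
      by (simp add: emeasure_pmf_single)
    finally show "emeasure (distr M (count_space UNIV) N) {a}
      = emeasure (measure_pmf (map_pmf enat (geometric_pos_pmf \<theta>))) {a}" .
  qed auto
qed

section \<open>Expected value and order estimate\<close>

lemma nn_integral_geometric_pos_pmf:
  assumes "0 < \<theta>" "\<theta> \<le> 1"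
  shows "(\<integral>\<^sup>+k. of_nat k \<partial>measure_pmf (geometric_pos_pmf \<theta>)) = ennreal (1 / \<theta>)"
proof -
  have int: "integrable (geometric_pmf \<theta>) real"
    using assms by (intro integrable_real_geometric_pmf) auto
  have "(\<integral>\<^sup>+k. of_nat k \<partial>measure_pmf (geometric_pos_pmf \<theta>))
    = (\<integral>\<^sup>+k. ennreal (1 + real k) \<partial>measure_pmf (geometric_pmf \<theta>))"
    by (auto simp: geometric_pos_pmf_def ennreal_of_nat_eq_real_of_nat intro!: nn_integral_cong)
  also have "\<dots> = ennreal (measure_pmf.expectation (geometric_pmf \<theta>) (\<lambda>k. 1 + real k))"
    using int by (intro nn_integral_eq_integral) auto
  \<comment> \<open>The mean number of failures is \<open>(1 - \<theta>) / \<theta>\<close>; the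
    successful trial adds 1.\<close>
  also have "measure_pmf.expectation (geometric_pmf \<theta>) (\<lambda>k. 1 + real k) = 1 + (1 - \<theta>) / \<theta>"
    using int assms by (simp add: expectation_geometric_pmf)
  also have "\<dots> = 1 / \<theta>"
    using assms by (simp add: field_simps)
  finally show ?thesis .
qed

text \<open>The constant \<open>(d + 1) ^ (d + 1)\<close> is the denominator of the lower bound
  \<open>(m / (d + 1)) ^ (d + 1)\<close> for the binomial coefficient of \<open>m\<close>; it
  depends on \<open>d\<close> alone.\<close>

lemma inverse_ransac_theta_le:
  assumes "d + 1 \<le> m" "m \<le> n"
  shows "1 / ransac_theta n m d \<le> real (d + 1) ^ (d + 1) * (real n / real m) ^ (d + 1)"
proof -
  let ?k = "d + 1"
  have lower: "(real m / real ?k) ^ ?k \<le> real (m choose ?k)"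
    using binomial_ge_n_over_k_pow_k[of ?k m, where ?'a = real] assms by simp
  have "real (n choose ?k) \<le> real n ^ ?k"
    using binomial_le_pow[of ?k n] assms by (metis of_nat_le_iff of_nat_power order_trans)
  then have "real (n choose ?k) / real (m choose ?k) \<le> real n ^ ?k / (real m / real ?k) ^ ?k"
    using assms lower by (intro frac_le) auto
  also have "\<dots> = real ?k ^ ?k * (real n / real m) ^ ?k"
    by (simp add: power_divide)
  finally show ?thesis
    by (simp add: ransac_theta_def)
qed

section \<open>Application to RANSAC\<close>

text \<open>Exactness has two forms: on every halting run the output is \<open>L\<close>, and since
  halting is almost sure, the output is \<open>L\<close> almost surely. In the order estimate
  \<open>C\<close> is chosen before \<open>n'\<close> and \<open>m'\<close>, so it depends on
  \<open>d'\<close> only.\<close>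

theorem proposition1:
  fixes x :: "nat \<Rightarrow> real ^ 'p"
    and L :: "(real ^ 'p) set"
    and n m d :: nat
    and M :: "'w measure"
    and draw :: "nat \<Rightarrow> 'w \<Rightarrow> nat set"
  assumes "1 \<le> d" and "d < CARD('p)"
    and "subspace L" and "dim L = d"
    and "card {i \<in> {1..n}. x i \<in> L} = m" and "d + 1 \<le> m"
    and "\<And>q T. q \<le> CARD('p) \<Longrightarrow> T \<in> data_tuples n q \<Longrightarrow>
           \<not> d + 1 \<le> card {i \<in> T. x i \<in> L} \<Longrightarrow> lin_indep_tuple x T"
    and "ransac_draws M n d draw"
  shows
    "(\<forall>\<omega>\<in>space M. ransac_halts x (\<lambda>k. draw k \<omega>) \<longrightarrow> ransac_output x (\<lambda>k. draw k \<omega>) = Some L) \<and>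
     (AE \<omega> in M. ransac_output x (\<lambda>k. draw k \<omega>) = Some L) \<and>
     (\<lambda>\<omega>. ransac_iterations x (\<lambda>k. draw k \<omega>)) \<in> measurable M (count_space UNIV) \<and>
     distr M (count_space UNIV) (\<lambda>\<omega>. ransac_iterations x (\<lambda>k. draw k \<omega>))
       = measure_pmf (map_pmf enat (geometric_pos_pmf (ransac_theta n m d))) \<and>
     (\<integral>\<^sup>+\<omega>. ennreal_of_enat (ransac_iterations x (\<lambda>k. draw k \<omega>)) \<partial>M)
       = ennreal (1 / ransac_theta n m d) \<and>
     1 / ransac_theta n m d = real (n choose (d + 1)) / real (m choose (d + 1)) \<and>
     (\<forall>d'. \<exists>C::real. \<forall>n' m'. d' + 1 \<le> m' \<and> m' \<le> n' \<longrightarrow>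
        1 / ransac_theta n' m' d' \<le> C * (real n' / real m') ^ (d' + 1))"
proof -
  let ?A = "data_tuples n (d + 1)" and ?\<theta> = "ransac_theta n m d"
  define I where "I = {i \<in> {1..n}. x i \<in> L}"
  have I: "finite I" "card I = m" "I \<subseteq> {1..n}"
    using assms(5) by (auto simp: I_def)
  then have "m \<le> n"
    using card_mono[of "{1..n}" I] by simp
  then have \<theta>: "0 < ?\<theta>" "?\<theta> \<le> 1"
    using assms(6) by (auto simp: ransac_theta_def binomial_right_mono)
  interpret prob_space M
    using assms(8) by (simp add: ransac_draws_def)
  have indep: "indep_vars (\<lambda>_. count_space ?A) draw UNIV"
    and unif: "distr M (count_space ?A) (draw k) = uniform_count_measure ?A" for k
    using assms(8) by (auto simp: ransac_draws_def)
  have draw: "draw k \<in> measurable M (count_space ?A)" for k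
    using indep by (simp add: indep_vars_def)
  have draw_in: "draw k \<omega> \<in> ?A" if "\<omega> \<in> space M" for k \<omega>
    using measurable_space[OF draw that] by simp

  let ?P = "\<lambda>k \<omega>. \<not> lin_indep_tuple x (draw k \<omega>)"
  have dep_iff: "\<not> lin_indep_tuple x T \<longleftrightarrow> x ` T \<subseteq> L" if "T \<in> ?A" for T
    by (rule lin_dep_tuple_iff[OF assms(4,2) _ that]) (rule assms(7))
  \<comment> \<open>This identifies the successful draws with the \<open>(d + 1)\<close>-subsets of
    the \<open>m\<close> indices in \<open>I\<close>, which gives the numerator of
    \<open>\<theta>\<close>.\<close>
  have dep_tuples: "{T \<in> ?A. \<not> lin_indep_tuple x T} = {T. T \<subseteq> I \<and> card T = d + 1}"
  proof -
    have "{T \<in> ?A. \<not> lin_indep_tuple x T} = {T \<in> ?A. x ` T \<subseteq> L}"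
      using dep_iff by blast
    also have "\<dots> = {T. T \<subseteq> I \<and> card T = d + 1}"
      by (auto simp: data_tuples_def I_def)
    finally show ?thesis .
  qed
  have prob: "prob {\<omega> \<in> space M. ?P k \<omega>} = ?\<theta>" for k
  proof -
    let ?D = "{T \<in> ?A. \<not> lin_indep_tuple x T}"
    have "prob {\<omega> \<in> space M. ?P k \<omega>} = prob (draw k -` ?D \<inter> space M)"
      using draw_in by (intro arg_cong[where f = prob]) auto
    also have "\<dots> = measure (uniform_count_measure ?A) ?D"
      unfolding unif[of k, symmetric] by (subst measure_distr[OF draw]) auto
    also have "\<dots> = card ?D / card ?A"
      by (subst measure_uniform_count_measure) (auto simp: finite_data_tuples)
    also have "\<dots> = ?\<theta>"
      unfolding dep_tuples using I
      by (simp add: n_subsets card_data_tuples ransac_theta_def)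
    finally show ?thesis .
  qed
  \<comment> \<open>Dependence of a tuple is a function of the single draw, and every function on a
    discrete space is measurable, so independence carries over.\<close>
  have indep': "indep_vars (\<lambda>_. count_space UNIV) ?P UNIV"
    by (rule indep_vars_compose2[OF indep, where Y = "\<lambda>_ T. \<not> lin_indep_tuple x T"]) simp
  note law = first_success_geometric[OF indep' prob \<theta>(1)]
  have iters: "ransac_iterations x (\<lambda>k. draw k \<omega>)
    = (if \<exists>k. ?P k \<omega> then enat (Suc (LEAST k. ?P k \<omega>)) else \<infinity>)" for \<omega>
    by (simp add: ransac_iterations_def ransac_halts_def)

  have exact: "ransac_output x (\<lambda>k. draw k \<omega>) = Some L"
    if "\<omega> \<in> space M" "ransac_halts x (\<lambda>k. draw k \<omega>)" for \<omega>
  proof -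
    let ?k = "LEAST k. ?P k \<omega>"
    have "?P ?k \<omega>"
      using that(2) unfolding ransac_halts_def by (rule LeastI_ex)
    then have in_L: "x ` draw ?k \<omega> \<subseteq> L"
      using dep_iff[OF draw_in[OF that(1)]] by blast
    have "span (x ` draw ?k \<omega>) = L"
      by (rule span_tuple_in_subspace[OF assms(3,4,2) _ draw_in[OF that(1)] in_L]) (rule assms(7))
    then show ?thesis
      using that(2) by (simp add: ransac_output_def)
  qed
  \<comment> \<open>Here \<open>law(3)\<close> supplies almost sure halting, and
    \<open>AE_space\<close> the membership in \<open>space M\<close> that \<open>exact\<close> asks
    for.\<close>
  have ae: "AE \<omega> in M. ransac_output x (\<lambda>k. draw k \<omega>) = Some L"
    using law(3) AE_space
  proof eventually_elim
    case (elim \<omega>)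
    then show ?case
      using exact[of \<omega>] by (simp add: ransac_halts_def)
  qed

  have meas: "(\<lambda>\<omega>. ransac_iterations x (\<lambda>k. draw k \<omega>)) \<in> measurable M (count_space UNIV)"
    unfolding iters by (rule law(1))
  have distr: "distr M (count_space UNIV) (\<lambda>\<omega>. ransac_iterations x (\<lambda>k. draw k \<omega>))
       = measure_pmf (map_pmf enat (geometric_pos_pmf ?\<theta>))"
    unfolding iters by (rule law(2))
  \<comment> \<open>Change of variables: the expectation depends only on the law of the iteration
    count, so the geometric mean value applies.\<close>
  have "(\<integral>\<^sup>+\<omega>. ennreal_of_enat (ransac_iterations x (\<lambda>k. draw k \<omega>)) \<partial>M)
    = (\<integral>\<^sup>+a. ennreal_of_enat a \<partial>measure_pmf (map_pmf enat (geometric_pos_pmf ?\<theta>)))"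
    unfolding distr[symmetric] by (subst nn_integral_distr[OF meas]) auto
  also have "\<dots> = ennreal (1 / ?\<theta>)"
    using \<theta> by (simp add: nn_integral_geometric_pos_pmf)
  finally have expect: "(\<integral>\<^sup>+\<omega>. ennreal_of_enat (ransac_iterations x (\<lambda>k. draw k \<omega>)) \<partial>M)
    = ennreal (1 / ?\<theta>)" .
  have inverse: "1 / ?\<theta> = real (n choose (d + 1)) / real (m choose (d + 1))"
    by (simp add: ransac_theta_def)
  have bound: "\<forall>d'. \<exists>C::real. \<forall>n' m'. d' + 1 \<le> m' \<and> m' \<le> n' \<longrightarrow>
        1 / ransac_theta n' m' d' \<le> C * (real n' / real m') ^ (d' + 1)"
    by (intro allI exI impI, elim conjE) (rule inverse_ransac_theta_le)
  show ?thesis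
    by (intro conjI ballI impI exact ae meas distr expect inverse bound)
qed

end
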